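(* The family $(\theta^{m_1}W^{(n)}Z^{m_2})$, indexed by $m_1,m_2\in\mathbb Z_{\ge0}$ and $n\in\mathbb Z$, is a basis of $U_q(\mathfrak g)$. For each $r\in\mathbb Z_{\ge0}$, write $$U_q(\mathfrak g)^{(r)}=\sum_{0\le n\le r}\theta^n\,\mathcal O_q(K\backslash U)^{(r-n)}.$$ Then $(U_q(\mathfrak g)^{(r)})_{r\ge0}$ is a filtration of the algebra $U_q(\mathfrak g)$.
   Context: $\mathbb K$ is an involutive extension of $\mathbb C$: an extension field of $\mathbb C$ equipped with an involutive automorphism restricting to complex conjugation on $\mathbb C$; an element is self-adjoint if it is fixed by the involution. $q\in\mathbb K^\times$ is not a root of unity and has self-adjoint square roots. $U_q(\mathfrak g)$ is the unital associative $\mathbb K$-algebra generated by $X,Y,Z,\theta$ subject to $XZ=q^2ZX$, $ZY=q^2YZ$, $XY+q^2Z^2=1$, $YX+q^{-2}Z^2=1$, $qX\theta-q^{-1}\theta X=q\theta Y-q^{-1}Y\theta=[2]_qZ$, $\theta Z-Z\theta=Y-X$, where $[2]_q=q+q^{-1}$. $\mathcal O_q(K\backslash U)$ is the unital subalgebra generated by $X,Y,Z$ (presented by the first four relations); multiplication gives a linear isomorphism $\mathbb K[\theta]\otimes\mathcal O_q(K\backslash U)\to U_q(\mathfrak g)$. For $n\in\mathbb Z$, $W^{(n)}=Y^n$ if $n\ge0$ and $W^{(n)}=X^{-n}$ if $n<0$. For $r\in\mathbb Z_{\ge0}$, $\mathcal O_q(K\backslash U)^{(r)}=\mathrm{span}(W^{(n)}Z^m:n\in\mathbb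 Z,\ m\ge0,\ |n|+m\le r)$. A filtration of an algebra $B$ is an increasing exhaustive sequence of subspaces $(B^{(r)})_{r\ge0}$ with $1\in B^{(0)}$ and $B^{(r)}B^{(s)}\subset B^{(r+s)}$. *)

theory Defs
  imports Complex_Main "HOL-Library.Poly_Mapping" "HOL-Library.Set_Algebras"
begin

section \<open>Involutive extensions of the complex numbers\<close>

locale involutive_extension =
  fixes emb :: "complex \<Rightarrow> 'k::field" and star :: "'k \<Rightarrow> 'k"
  assumes emb_add: "emb (z + w) = emb z + emb w"
    and emb_mult: "emb (z * w) = emb z * emb w"
    and emb_one: "emb 1 = 1"
    and star_add: "star (a + b) = star a + star b"
    and star_mult: "star (a * b) = star a * star b"
    and star_one: "star 1 = 1"
    and star_star: "star (star a) = a"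
    and star_emb: "star (emb z) = emb (cnj z)"
begin

definition self_adjoint :: "'k \<Rightarrow> bool" where
  "self_adjoint a \<longleftrightarrow> star a = a"

end


section \<open>Unital associative algebras, bases and filtrations\<close>

text \<open>The sort \<open>{ring, monoid_mult}\<close> is that of unital associative rings in which
  \<open>1 = 0\<close> is not excluded (as opposed to \<open>ring_1\<close>).\<close>

locale unital_algebra = vector_space scale
  for scale :: "'k::field \<Rightarrow> 'a::{ring, monoid_mult} \<Rightarrow> 'a" +
  assumes scale_mult_left: "scale c a * b = scale c (a * b)"
    and scale_mult_right: "a * scale c b = scale c (a * b)"

definition is_basis_family ::
    "('k::field \<Rightarrow> 'a::ab_group_add \<Rightarrow> 'a) \<Rightarrow> ('i \<Rightarrow> 'a) \<Rightarrow> bool" where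
  "is_basis_family scale f \<longleftrightarrow>
     inj f \<and> module.independent scale (range f) \<and> module.span scale (range f) = UNIV"

text \<open>The product of subsets is the one of \<open>Set_Algebras\<close>, i.e. the set of all products; since
  \<open>B (r + s)\<close> is a subspace, the condition is the same for the span of this set.\<close>

definition algebra_filtration ::
    "('k::field \<Rightarrow> 'a::{ring, monoid_mult} \<Rightarrow> 'a) \<Rightarrow> (nat \<Rightarrow> 'a set) \<Rightarrow> bool" where
  "algebra_filtration scale B \<longleftrightarrow>
     (\<forall>r. module.subspace scale (B r)) \<and> mono B \<and> (\<Union>r. B r) = UNIV \<and>
     1 \<in> B 0 \<and> (\<forall>r s. B r * B s \<subseteq> B (r + s))"


section \<open>Free algebras and presentations\<close>

text \<open>Words, written additively with concatenation as addition, so that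
  \<open>'g fword \<Rightarrow>\<^sub>0 'k\<close> with the convolution product of \<open>Poly_Mapping\<close>
  is the free unital associative \<open>'k\<close>-algebra on the generators \<open>'g\<close>.\<close>

datatype 'g fword = FWord (letters: "'g list")

instantiation fword :: (type) monoid_add
begin

definition zero_fword :: "'g fword" where
  "zero_fword = FWord []"

definition plus_fword :: "'g fword \<Rightarrow> 'g fword \<Rightarrow> 'g fword" where
  "plus_fword u v = FWord (letters u @ letters v)"

instance
  by standard (simp_all add: zero_fword_def plus_fword_def)

end

type_synonym ('g, 'k) free_algebra = "'g fword \<Rightarrow>\<^sub>0 'k"

definition fgen :: "'g \<Rightarrow> ('g, 'k::field) free_algebra" where
  "fgen g = Poly_Mapping.single (FWord [g]) 1"

definition fconst :: "'k::field \<Rightarrow> ('g, 'k) free_algebra" where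
  "fconst c = Poly_Mapping.single 0 c"

definition free_eval ::
    "('k::field \<Rightarrow> 'a::{ring, monoid_mult} \<Rightarrow> 'a) \<Rightarrow> ('g \<Rightarrow> 'a) \<Rightarrow> ('g, 'k) free_algebra \<Rightarrow> 'a" where
  "free_eval scale x p =
     (\<Sum>w\<in>Poly_Mapping.keys p.
        scale (Poly_Mapping.lookup p w) (prod_list (map x (letters w))))"

inductive_set two_sided_ideal :: "'a::ring_1 set \<Rightarrow> 'a set" for R :: "'a set" where
  generator: "r \<in> R \<Longrightarrow> r \<in> two_sided_ideal R"
| zero: "0 \<in> two_sided_ideal R"
| add: "a \<in> two_sided_ideal R \<Longrightarrow> b \<in> two_sided_ideal R \<Longrightarrow> a + b \<in> two_sided_ideal R"
| mult_left: "a \<in> two_sided_ideal R \<Longrightarrow> c * a \<in> two_sided_ideal R"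
| mult_right: "a \<in> two_sided_ideal R \<Longrightarrow> a * c \<in> two_sided_ideal R"

text \<open>The algebra \<open>'a\<close> is generated by the \<open>x g\<close> subject to the relations \<open>r = 0\<close>, \<open>r \<in> R\<close>:
  the canonical map from the free algebra induces an isomorphism from the quotient by the
  two-sided ideal generated by \<open>R\<close> onto \<open>'a\<close>.\<close>

definition presented_by ::
    "('k::field \<Rightarrow> 'a::{ring, monoid_mult} \<Rightarrow> 'a) \<Rightarrow> ('g \<Rightarrow> 'a) \<Rightarrow> ('g, 'k) free_algebra set \<Rightarrow> bool"
  where
  "presented_by scale x R \<longleftrightarrow>
     unital_algebra scale \<and> surj (free_eval scale x) \<and>
     {p. free_eval scale x p = 0} = two_sided_ideal R"


section \<open>The algebra \<open>U\<^sub>q(g)\<close>\<close>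

datatype uq_gen = GenX | GenY | GenZ | GenTheta

definition uq_relators :: "'k::field \<Rightarrow> (uq_gen, 'k) free_algebra set" where
  "uq_relators q =
     (let X = fgen GenX; Y = fgen GenY; Z = fgen GenZ; \<theta> = fgen GenTheta;
          two_q = q + inverse q
      in { X * Z - fconst (q\<^sup>2) * Z * X,
           Z * Y - fconst (q\<^sup>2) * Y * Z,
           X * Y + fconst (q\<^sup>2) * Z\<^sup>2 - 1,
           Y * X + fconst (inverse (q\<^sup>2)) * Z\<^sup>2 - 1,
           fconst q * X * \<theta> - fconst (inverse q) * \<theta> * X - fconst two_q * Z,
           fconst q * \<theta> * Y - fconst (inverse q) * Y * \<theta> - fconst two_q * Z,
           \<theta> * Z - Z * \<theta> - (Y - X) })"

definition is_Uq ::
    "'k::field \<Rightarrow> ('k \<Rightarrow> 'a::{ring, monoid_mult} \<Rightarrow> 'a) \<Rightarrow> 'a \<Rightarrow> 'a \<Rightarrow> 'a \<Rightarrow> 'a \<Rightarrow> bool" where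
  "is_Uq q scale X Y Z \<theta> \<longleftrightarrow>
     presented_by scale
       (\<lambda>g. case g of GenX \<Rightarrow> X | GenY \<Rightarrow> Y | GenZ \<Rightarrow> Z | GenTheta \<Rightarrow> \<theta>)
       (uq_relators q)"

definition W_elt :: "'a::monoid_mult \<Rightarrow> 'a \<Rightarrow> int \<Rightarrow> 'a" where
  "W_elt X Y n = (if n \<ge> 0 then Y ^ nat n else X ^ nat (- n))"

definition O_filt ::
    "('k::field \<Rightarrow> 'a::{ring, monoid_mult} \<Rightarrow> 'a) \<Rightarrow> 'a \<Rightarrow> 'a \<Rightarrow> 'a \<Rightarrow> nat \<Rightarrow> 'a set" where
  "O_filt scale X Y Z r =
     module.span scale {W_elt X Y n * Z ^ m | n m. nat \<bar>n\<bar> + m \<le> r}"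

text \<open>Here \<open>\<Sum>\<close> is the Minkowski sum and \<open>a *o S\<close> the set of all \<open>a * s\<close> with \<open>s \<in> S\<close>.\<close>

definition Uq_filt ::
    "('k::field \<Rightarrow> 'a::{ring, monoid_mult} \<Rightarrow> 'a) \<Rightarrow> 'a \<Rightarrow> 'a \<Rightarrow> 'a \<Rightarrow> 'a \<Rightarrow> nat \<Rightarrow> 'a set" where
  "Uq_filt scale X Y Z \<theta> r = (\<Sum>n\<in>{0..r}. (\<theta> ^ n) *o O_filt scale X Y Z (r - n))"

end

theory Submission
  imports Defs "HOL-Library.Function_Algebras"
begin

text \<open>
  Moving \<open>X\<close>, \<open>Y\<close>, \<open>Z\<close> to the right of \<open>\<theta>\<close> with the relations never raises the total degree
  \<open>m + \<bar>n\<bar> + k\<close> of \<open>\<theta>\<^sup>m W\<^sup>(\<^sup>n\<^sup>) Z\<^sup>k\<close>. Hence left multiplication by a generator raises the degree of a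
  combination of such monomials by at most one (\<open>generators_filt\<close>). This gives at once that the
  monomials span and that the spans of the monomials of degree at most \<open>r\<close>, which are the spaces
  \<open>U\<^sub>q(g)\<^sup>(\<^sup>r\<^sup>)\<close>, are multiplicative.

  Linear independence needs a sufficiently large module. Take the quantum torus with invertible
  generators \<open>u\<close>, \<open>z\<close> and \<open>u z = q\<^sup>2 z u\<close>, and adjoin a central variable \<open>\<lambda>\<close>. The relations
  hold for
    \<open>X = u\<close>, \<open>Z = z\<close>, \<open>Y = u\<^sup>-\<^sup>1 (1 - q\<^sup>2 z\<^sup>2)\<close>,
    \<open>\<theta> = z\<^sup>-\<^sup>1 \<lambda> - (z\<^sup>-\<^sup>1 X + Y z\<^sup>-\<^sup>1) / (q\<^sup>2 - 1)\<close>.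
  The reason for the formula for \<open>\<theta>\<close> is that commuting past \<open>\<theta>\<close> twists \<open>X\<close> and \<open>Y\<close> in the same
  way as conjugation by \<open>z\<close> does, and that the remaining twisted derivation becomes inner in the
  torus; \<open>z\<^sup>-\<^sup>1 \<lambda>\<close> is the freedom left in the choice of \<open>\<theta>\<close>, and without it the powers of \<open>\<theta>\<close>
  would not be independent over the subalgebra generated by \<open>X\<close>, \<open>Y\<close>, \<open>Z\<close>. Since the algebra is
  defined by its relations, it acts on formal
  sums of torus monomials (\<open>presented_by_module_map\<close>), and
  \<open>\<theta>\<^sup>m W\<^sup>(\<^sup>n\<^sup>) Z\<^sup>k\<close> sends \<open>1\<close> to an element with top \<open>\<lambda>\<close>-degree \<open>m\<close>, whose \<open>\<lambda>\<^sup>m\<close>-part lies in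
  \<open>u\<close>-degree \<open>- n\<close> and has lowest \<open>z\<close>-degree \<open>k - m\<close> (\<open>leads_torus_action\<close>). These leading
  degrees are distinct, so the images are linearly independent
  (\<open>triangular_family_independent\<close>), and then so are the monomials.
\<close>

section \<open>Modules over presented algebras\<close>

locale free_algebra_action = vector_space s
  for s :: "'k::field \<Rightarrow> 'v::ab_group_add \<Rightarrow> 'v" +
  fixes T :: "'g \<Rightarrow> 'v \<Rightarrow> 'v"
  assumes T_add: "T g (v + w) = T g v + T g w"
    and T_scale: "T g (s c v) = s c (T g v)"
begin

definition word_act :: "'g fword \<Rightarrow> 'v \<Rightarrow> 'v" where
  "word_act w = foldr T (letters w)"

definition act :: "('g, 'k) free_algebra \<Rightarrow> 'v \<Rightarrow> 'v" where
  "act p v = (\<Sum>w\<in>Poly_Mapping.keys p. s (Poly_Mapping.lookup p w) (word_act w v))"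

lemma word_act_0 [simp]: "word_act 0 v = v"
  by (simp add: word_act_def zero_fword_def)

lemma word_act_plus: "word_act (u + w) v = word_act u (word_act w v)"
  by (simp add: word_act_def plus_fword_def)

lemma word_act_add: "word_act w (v + v') = word_act w v + word_act w v'"
proof -
  have "foldr T ws (v + v') = foldr T ws v + foldr T ws v'" for ws
    by (induction ws) (simp_all add: T_add)
  then show ?thesis by (simp add: word_act_def)
qed

lemma word_act_scale: "word_act w (s c v) = s c (word_act w v)"
proof -
  have "foldr T ws (s c v) = s c (foldr T ws v)" for ws
    by (induction ws) (simp_all add: T_scale)
  then show ?thesis by (simp add: word_act_def)
qed

lemma act_superset:
  assumes "finite A" "Poly_Mapping.keys p \<subseteq> A"
  shows "act p v = (\<Sum>w\<in>A. s (Poly_Mapping.lookup p w) (word_act w v))"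
  unfolding act_def
  by (rule sum.mono_neutral_left) (use assms in \<open>auto simp: in_keys_iff\<close>)

lemma act_plus: "act (p + p') v = act p v + act p' v"
proof -
  let ?A = "Poly_Mapping.keys p \<union> Poly_Mapping.keys p'"
  have "act r v = (\<Sum>w\<in>?A. s (Poly_Mapping.lookup r w) (word_act w v))"
    if "r \<in> {p, p', p + p'}" for r
    by (rule act_superset) (use that Poly_Mapping.keys_add[of p p'] in auto)
  then show ?thesis
    by (simp add: lookup_add scale_left_distrib sum.distrib)
qed

lemma act_0 [simp]: "act 0 v = 0"
  by (simp add: act_def)

lemma act_diff: "act (p - p') v = act p v - act p' v"
  using act_plus[of "p - p'" p' v] by simp

lemma act_sum: "act (sum f A) v = (\<Sum>i\<in>A. act (f i) v)"
  by (induction A rule: infinite_finite_induct) (simp_all add: act_plus)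

lemma act_single: "act (Poly_Mapping.single w c) v = s c (word_act w v)"
  by (cases "c = 0") (simp_all add: act_def)

lemma act_one [simp]: "act 1 v = v"
  using act_single[of 0 1 v] by simp

lemma act_fgen [simp]: "act (fgen g) v = T g v"
  by (simp add: fgen_def act_single word_act_def)

lemma act_fconst [simp]: "act (fconst c) v = s c v"
  by (simp add: fconst_def act_single)

lemma act_add_right: "act p (v + v') = act p v + act p v'"
  by (simp add: act_def word_act_add scale_right_distrib sum.distrib)

lemma act_zero_right [simp]: "act p 0 = 0"
  using act_add_right[of p 0 0] by simp

lemma act_sum_right: "act p (sum f A) = (\<Sum>i\<in>A. act p (f i))"
  by (induction A rule: infinite_finite_induct) (simp_all add: act_add_right)

lemma free_algebra_sum_singles:
  fixes p :: "('g, 'k) free_algebra"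
  shows "p = (\<Sum>w\<in>Poly_Mapping.keys p. Poly_Mapping.single w (Poly_Mapping.lookup p w))"
  by (rule poly_mapping_eqI)
    (simp add: lookup_sum lookup_single when_def in_keys_iff)

text \<open>This makes \<open>act\<close> a module structure over the free algebra: both sides are bilinear in \<open>p\<close> and
  \<open>r\<close>, and on words the product is concatenation.\<close>

lemma act_times: "act (p * r) v = act p (act r v)"
proof -
  define S where "S = (\<lambda>p::('g, 'k) free_algebra. \<lambda>w. Poly_Mapping.single w (Poly_Mapping.lookup p w))"
  have S: "p = sum (S p) (Poly_Mapping.keys p)" for p
    using free_algebra_sum_singles[of p] by (simp add: S_def)
  have "act (S p u * S r w) v = act (S p u) (act (S r w) v)" for u w
    by (simp add: S_def mult_single act_single word_act_plus word_act_scale)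
  then have "act (sum (S p) (Poly_Mapping.keys p) * sum (S r) (Poly_Mapping.keys r)) v =
      act (sum (S p) (Poly_Mapping.keys p)) (act (sum (S r) (Poly_Mapping.keys r)) v)"
    by (simp add: sum_product act_sum act_sum_right) (rule sum.swap)
  then show ?thesis
    using S by simp
qed

lemma act_two_sided_ideal:
  assumes "p \<in> two_sided_ideal R" and "\<And>r v. r \<in> R \<Longrightarrow> act r v = 0"
  shows "act p v = 0"
  using assms(1)
  by (induction arbitrary: v) (simp_all add: assms(2) act_plus act_times)

end

context unital_algebra
begin

lemma left_mult_action: "free_algebra_action scale (\<lambda>g a. x g * a)"
  by unfold_locales (simp_all add: distrib_left scale_mult_right)

text \<open>Evaluation of noncommutative polynomials is the special case of the action by left
  multiplication, so that the rules for \<open>act\<close> also compute \<open>free_eval\<close>.\<close>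

lemma free_eval_mult_eq_act:
  "free_eval scale x p * a = free_algebra_action.act scale (\<lambda>g a. x g * a) p a"
proof -
  interpret L: free_algebra_action scale "\<lambda>g a. x g * a"
    by (rule left_mult_action)
  have "foldr (\<lambda>g. (*) (x g)) ws a = prod_list (map x ws) * a" for ws
    by (induction ws) (simp_all add: mult.assoc)
  then show ?thesis
    by (simp add: free_eval_def L.act_def L.word_act_def sum_distrib_right scale_mult_left)
qed

lemma free_eval_eq_act:
  "free_eval scale x p = free_algebra_action.act scale (\<lambda>g a. x g * a) p 1"
  using free_eval_mult_eq_act[of x p 1] by simp

end

text \<open>Operators that satisfy the relations turn \<open>'v\<close> into a module over the presented algebra; the map
  below is the orbit map \<open>a \<mapsto> a e\<close> of a vector \<open>e\<close>. It is well defined because two noncommutative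
  polynomials with the same value differ by an element of the ideal of relations, which acts by
  zero.\<close>

lemma presented_by_module_map:
  fixes scale :: "'k::field \<Rightarrow> 'a::{ring, monoid_mult} \<Rightarrow> 'a" and x :: "'g \<Rightarrow> 'a"
    and s :: "'k \<Rightarrow> 'v::ab_group_add \<Rightarrow> 'v" and T :: "'g \<Rightarrow> 'v \<Rightarrow> 'v"
  assumes pres: "presented_by scale x R"
    and action: "free_algebra_action s T"
    and rel: "\<And>r v. r \<in> R \<Longrightarrow> free_algebra_action.act s T r v = 0"
  obtains L where "Vector_Spaces.linear scale s L" "L 1 = e" "\<And>g a. L (x g * a) = T g (L a)"
proof -
  interpret A: unital_algebra scale
    using pres by (simp add: presented_by_def)
  interpret V: free_algebra_action s T
    by (rule action)
  interpret R: free_algebra_action scale "\<lambda>g a. x g * a"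
    by (rule A.left_mult_action)
  let ?ev = "free_eval scale x"
  have ev: "?ev p = R.act p 1" for p
    by (rule A.free_eval_eq_act)
  have ex: "\<exists>p. ?ev p = a" for a
    using pres unfolding presented_by_def surj_def by metis
  define L where "L a = V.act (SOME p. ?ev p = a) e" for a
  have L: "L (?ev p) = V.act p e" for p
  proof -
    let ?p' = "SOME p'. ?ev p' = ?ev p"
    have "?ev ?p' = ?ev p"
      by (rule someI) simp
    then have "?ev (?p' - p) = 0"
      by (simp add: ev R.act_diff)
    then have "?p' - p \<in> two_sided_ideal R"
      using pres by (auto simp: presented_by_def)
    then have "V.act (?p' - p) e = 0"
      using rel by (rule V.act_two_sided_ideal)
    then show ?thesis
      by (simp add: L_def V.act_diff)
  qed
  show ?thesis
  proof (rule that)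
    show "L 1 = e"
      using L[of 1] by (simp add: ev)
  next
    fix g a
    obtain p where p: "?ev p = a" using ex by blast
    have "?ev (fgen g * p) = x g * a"
      by (simp add: ev R.act_times flip: p)
    then show "L (x g * a) = T g (L a)"
      using L[of "fgen g * p"] L[of p] p by (simp add: V.act_times)
  next
    show "Vector_Spaces.linear scale s L"
    proof (intro Vector_Spaces.linear.intro module_hom.intro module_hom_axioms.intro)
        fix a b
        obtain p r where pr: "?ev p = a" "?ev r = b" using ex by metis
        have "?ev (p + r) = a + b"
          by (simp add: ev R.act_plus flip: pr)
        then show "L (a + b) = L a + L b"
          using L[of "p + r"] L[of p] L[of r] pr by (simp add: V.act_plus)
    next
        fix c a
        obtain p where p: "?ev p = a" using ex by blast
        have "?ev (fconst c * p) = scale c a"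
          by (simp add: ev R.act_times flip: p)
        then show "L (scale c a) = s c (L a)"
          using L[of "fconst c * p"] L[of p] p by (simp add: V.act_times)
    qed (rule A.vector_space_axioms V.vector_space_axioms A.module_axioms V.module_axioms)+
  qed
qed

section \<open>Triangular families\<close>

text \<open>In a vanishing linear combination, the functional \<open>\<phi>\<close> for the set \<open>S\<close> of indices with nonzero
  coefficient isolates a single term, which is not zero. For injectivity take for \<open>S\<close> two
  indices with the same image.\<close>

lemma (in vector_space) triangular_family_independent:
  assumes tri: "\<And>S. finite S \<Longrightarrow> S \<noteq> {} \<Longrightarrow>
      \<exists>i\<in>S. \<exists>\<phi>. Vector_Spaces.linear scale (*) \<phi> \<and> \<phi> (f i) \<noteq> 0 \<and> (\<forall>j\<in>S - {i}. \<phi> (f j) = 0)"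
  shows "inj f" and "independent (range f)"
proof -
  show inj: "inj f"
  proof (rule injI, rule ccontr)
    fix i j assume "f i = f j" "i \<noteq> j"
    then have "{i, j} - {i} = {j}" "{i, j} - {j} = {i}" by auto
    with tri[of "{i, j}"] \<open>f i = f j\<close> show False by auto
  qed
  show "independent (range f)"
    unfolding independent_explicit_module
  proof (intro allI impI)
    fix t u v
    assume t: "finite t" "t \<subseteq> range f" and sum: "(\<Sum>v\<in>t. scale (u v) v) = 0" and v: "v \<in> t"
    show "u v = 0"
    proof (rule ccontr)
      assume "u v \<noteq> 0"
      define S where "S = {i. f i \<in> t \<and> u (f i) \<noteq> 0}"
      have "finite S"
        by (rule finite_subset[OF _ finite_vimageI[OF t(1) inj]]) (auto simp: S_def)
      moreover have "S \<noteq> {}"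
        using t(2) v \<open>u v \<noteq> 0\<close> by (auto simp: S_def)
      ultimately obtain i \<phi> where i: "i \<in> S" and \<phi>: "Vector_Spaces.linear scale (*) \<phi>"
        and nz: "\<phi> (f i) \<noteq> 0" and z: "\<forall>j\<in>S - {i}. \<phi> (f j) = 0"
        using tri[of S] by auto
      interpret \<phi>: Vector_Spaces.linear scale "(*)" \<phi> by (rule \<phi>)
      have "0 = \<phi> (\<Sum>v\<in>t. scale (u v) v)"
        by (simp add: sum \<phi>.zero)
      also have "\<dots> = (\<Sum>v\<in>t. u v * \<phi> v)"
        by (simp add: \<phi>.sum \<phi>.scale)
      also have "\<dots> = (\<Sum>v\<in>{f i}. u v * \<phi> v)"
      proof (rule sum.mono_neutral_right)
        show "\<forall>w\<in>t - {f i}. u w * \<phi> w = 0"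
        proof
          fix w assume w: "w \<in> t - {f i}"
          then obtain j where j: "w = f j" using t(2) by auto
          show "u w * \<phi> w = 0"
            using w z by (cases "u w = 0") (auto simp: j S_def)
        qed
      qed (use i t in \<open>auto simp: S_def\<close>)
      finally show False
        using i nz by (simp add: S_def)
    qed
  qed
qed

section \<open>An action on formal series over a quantum torus\<close>

text \<open>The function \<open>f\<close> stands for the formal sum of the \<open>f a b c \<lambda>\<^sup>a u\<^sup>b z\<^sup>c\<close>. No support condition is
  imposed, since the operators below are finite sums of weighted shifts and make sense on all
  functions. From \<open>u z = q\<^sup>2 z u\<close> one gets \<open>z u\<^sup>b z\<^sup>c = q\<^sup>-\<^sup>2\<^sup>b u\<^sup>b z\<^sup>c\<^sup>+\<^sup>1\<close>, which is the weight in
  the action of \<open>Z\<close>.\<close>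

type_synonym 'k torus_series = "int \<Rightarrow> int \<Rightarrow> int \<Rightarrow> 'k"

definition series_scale :: "'k::field \<Rightarrow> 'k torus_series \<Rightarrow> 'k torus_series" where
  "series_scale k f = (\<lambda>a b c. k * f a b c)"

definition torus_X :: "'k::field torus_series \<Rightarrow> 'k torus_series" where
  "torus_X f = (\<lambda>a b c. f a (b - 1) c)"

text \<open>Left multiplication by \<open>u\<^sup>-\<^sup>1 (1 - q\<^sup>2 z\<^sup>2)\<close>.\<close>

definition torus_Y :: "'k::field \<Rightarrow> 'k torus_series \<Rightarrow> 'k torus_series" where
  "torus_Y q f = (\<lambda>a b c. f a (b + 1) c - q\<^sup>2 / (q powi (b + 1)) ^ 4 * f a (b + 1) (c - 2))"

definition torus_Z :: "'k::field \<Rightarrow> 'k torus_series \<Rightarrow> 'k torus_series" where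
  "torus_Z q f = (\<lambda>a b c. f a b (c - 1) / (q powi b)\<^sup>2)"

definition torus_Z_inv :: "'k::field \<Rightarrow> 'k torus_series \<Rightarrow> 'k torus_series" where
  "torus_Z_inv q f = (\<lambda>a b c. (q powi b)\<^sup>2 * f a b (c + 1))"

text \<open>Left multiplication by \<open>z\<^sup>-\<^sup>1 \<lambda> - (z\<^sup>-\<^sup>1 X + Y z\<^sup>-\<^sup>1) / (q\<^sup>2 - 1)\<close>.\<close>

definition torus_theta :: "'k::field \<Rightarrow> 'k torus_series \<Rightarrow> 'k torus_series" where
  "torus_theta q f = (\<lambda>a b c. torus_Z_inv q f (a - 1) b c
     - (torus_Z_inv q (torus_X f) a b c + torus_Y q (torus_Z_inv q f) a b c) / (q\<^sup>2 - 1))"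

definition torus_action :: "'k::field \<Rightarrow> uq_gen \<Rightarrow> 'k torus_series \<Rightarrow> 'k torus_series" where
  "torus_action q g =
    (case g of GenX \<Rightarrow> torus_X | GenY \<Rightarrow> torus_Y q | GenZ \<Rightarrow> torus_Z q | GenTheta \<Rightarrow> torus_theta q)"

lemmas torus_defs = torus_X_def torus_Y_def torus_Z_def torus_Z_inv_def torus_theta_def

lemma torus_action_free: "free_algebra_action series_scale (torus_action q)"
proof (intro free_algebra_action.intro free_algebra_action_axioms.intro)
  show "vector_space (series_scale :: 'a \<Rightarrow> _)"
    by unfold_locales (auto simp: series_scale_def fun_eq_iff algebra_simps)
  show "torus_action q g (v + w) = torus_action q g v + torus_action q g w" for g v w
    by (auto simp: torus_action_def torus_defs fun_eq_iff add_divide_distrib diff_divide_distrib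
        algebra_simps split: uq_gen.split)
  show "torus_action q g (series_scale c v) = series_scale c (torus_action q g v)" for g c v
    by (auto simp: series_scale_def torus_action_def torus_defs fun_eq_iff
        add_divide_distrib diff_divide_distrib algebra_simps split: uq_gen.split)
qed

text \<open>After expanding at one point \<open>(a, b, c)\<close> and reducing all weights to \<open>q powi b\<close>, every relation
  is an identity of rational functions in \<open>q\<close> and \<open>q powi b\<close>. Only the denominator \<open>q\<^sup>2 - 1\<close> of
  \<open>\<theta>\<close> is not a monomial; it is kept as an atom \<open>d\<close> while denominators are cleared, and
  \<open>q\<^sup>2 = d + 1\<close> enters only in the last step.\<close>

lemma torus_relations:
  fixes q :: "'k::field"
  assumes q: "q \<noteq> 0" "q\<^sup>2 \<noteq> 1"
  shows "torus_X (torus_Z q f) = series_scale (q\<^sup>2) (torus_Z q (torus_X f))"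
    and "torus_Z q (torus_Y q f) = series_scale (q\<^sup>2) (torus_Y q (torus_Z q f))"
    and "torus_X (torus_Y q f) + series_scale (q\<^sup>2) (torus_Z q (torus_Z q f)) = f"
    and "torus_Y q (torus_X f) + series_scale (inverse (q\<^sup>2)) (torus_Z q (torus_Z q f)) = f"
    and "series_scale q (torus_X (torus_theta q f)) - series_scale (inverse q) (torus_theta q (torus_X f))
      = series_scale (q + inverse q) (torus_Z q f)"
    and "series_scale q (torus_theta q (torus_Y q f)) - series_scale (inverse q) (torus_Y q (torus_theta q f))
      = series_scale (q + inverse q) (torus_Z q f)"
    and "torus_theta q (torus_Z q f) - torus_Z q (torus_theta q f) = torus_Y q f - torus_X f"
proof -
  define d where "d = q\<^sup>2 - 1"
  have d: "d \<noteq> 0" "q\<^sup>2 = d + 1" using q by (simp_all add: d_def)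
  have powi: "q powi (b + 1) = q * q powi b" "q powi (b - 1) = q powi b / q"
      "q powi (b + 2) = q\<^sup>2 * q powi b" "q powi b \<noteq> 0" for b
    using q by (simp_all add: power_int_add power_int_diff)
  note defs = fun_eq_iff series_scale_def torus_defs powi d_def[symmetric]
  show "torus_X (torus_Z q f) = series_scale (q\<^sup>2) (torus_Z q (torus_X f))"
    using q by (simp add: defs field_simps)
  show "torus_Z q (torus_Y q f) = series_scale (q\<^sup>2) (torus_Y q (torus_Z q f))"
    using q by (simp add: defs) (simp add: field_simps eval_nat_numeral)
  show "torus_X (torus_Y q f) + series_scale (q\<^sup>2) (torus_Z q (torus_Z q f)) = f"
    using q by (simp add: defs)
  show "torus_Y q (torus_X f) + series_scale (inverse (q\<^sup>2)) (torus_Z q (torus_Z q f)) = f"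
    using q by (simp add: defs) (simp add: field_simps eval_nat_numeral)
  show "series_scale q (torus_X (torus_theta q f)) - series_scale (inverse q) (torus_theta q (torus_X f))
      = series_scale (q + inverse q) (torus_Z q f)"
    using q d(1) by (intro ext, simp add: defs) (simp add: field_simps, use d(2) in algebra)
  show "series_scale q (torus_theta q (torus_Y q f)) - series_scale (inverse q) (torus_Y q (torus_theta q f))
      = series_scale (q + inverse q) (torus_Z q f)"
    using q d(1) by (intro ext, simp add: defs) (simp add: field_simps, use d(2) in algebra)
  show "torus_theta q (torus_Z q f) - torus_Z q (torus_theta q f) = torus_Y q f - torus_X f"
    using q d(1) by (intro ext, simp add: defs) (simp add: field_simps, use d(2) in algebra)
qed

lemma torus_action_relators:
  fixes q :: "'k::field"
  assumes "q \<noteq> 0" "q\<^sup>2 \<noteq> 1" "r \<in> uq_relators q"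
  shows "free_algebra_action.act series_scale (torus_action q) r f = 0"
proof -
  interpret free_algebra_action series_scale "torus_action q"
    by (rule torus_action_free)
  show ?thesis
    using assms(3) torus_relations[OF assms(1,2), of f]
    by (auto simp: uq_relators_def Let_def act_diff act_plus act_times power2_eq_square[of "fgen _"]
      torus_action_def)
qed

text \<open>Leading exponents: \<open>a\<close> is the highest exponent of \<open>\<lambda>\<close>, the coefficient of \<open>\<lambda>\<^sup>a\<close> is homogeneous
  in \<open>u\<close> of degree \<open>b\<close>, and \<open>c\<close> is the lowest exponent of \<open>z\<close> in it.\<close>

definition leads :: "'k::field torus_series \<Rightarrow> int \<Rightarrow> int \<Rightarrow> int \<Rightarrow> bool" where
  "leads f a b c \<longleftrightarrow> f a b c \<noteq> 0 \<and>
     (\<forall>a' b' c'. f a' b' c' \<noteq> 0 \<longrightarrow> a' < a \<or> a' = a \<and> b' = b \<and> c \<le> c')"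

text \<open>In \<open>Y = u\<^sup>-\<^sup>1 (1 - q\<^sup>2 z\<^sup>2)\<close> the term \<open>u\<^sup>-\<^sup>1\<close> is lowest in \<open>z\<close>, and in \<open>\<theta>\<close> only the term
  \<open>z\<^sup>-\<^sup>1 \<lambda>\<close> raises the degree in \<open>\<lambda>\<close>. So each generator acts on leading exponents by a shift.\<close>

lemma leads_torus_action:
  assumes "leads f a b c" "q \<noteq> 0"
  shows "leads (torus_action q GenX f) a (b + 1) c"
    and "leads (torus_action q GenY f) a (b - 1) c"
    and "leads (torus_action q GenZ f) a b (c + 1)"
    and "leads (torus_action q GenTheta f) (a + 1) b (c - 1)"
proof -
  have nz: "f a b c \<noteq> 0"
    and out: "\<And>a' b' c'. a < a' \<Longrightarrow> f a' b' c' = 0" "\<And>b' c'. b' \<noteq> b \<Longrightarrow> f a b' c' = 0"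
      "\<And>c'. c' < c \<Longrightarrow> f a b c' = 0"
    using assms(1) unfolding leads_def by force+
  have char: "leads g a' b' c'"
    if "g a' b' c' \<noteq> 0" "\<And>i j k. a' < i \<Longrightarrow> g i j k = 0" "\<And>j k. j \<noteq> b' \<Longrightarrow> g a' j k = 0"
      "\<And>k. k < c' \<Longrightarrow> g a' b' k = 0"
    for g :: "'a torus_series" and a' b' c'
    using that unfolding leads_def by (metis linorder_not_less linorder_less_linear)
  show "leads (torus_action q GenX f) a (b + 1) c"
    by (rule char) (use nz out in \<open>simp_all add: torus_action_def torus_defs\<close>)
  show "leads (torus_action q GenY f) a (b - 1) c"
    by (rule char) (use nz out in \<open>simp_all add: torus_action_def torus_defs\<close>)
  show "leads (torus_action q GenZ f) a b (c + 1)"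
    by (rule char) (use nz out assms(2) in \<open>simp_all add: torus_action_def torus_defs\<close>)
  show "leads (torus_action q GenTheta f) (a + 1) b (c - 1)"
    by (rule char) (use nz out assms(2) in \<open>simp_all add: torus_action_def torus_defs\<close>)
qed


section \<open>Spanning and multiplication of normally ordered monomials\<close>

text \<open>The relations as rewriting rules towards the normal order \<open>\<theta>\<close>, then \<open>X\<close> or \<open>Y\<close>, then \<open>Z\<close>;
  the coefficients come from solving for the left-hand sides.\<close>

locale uq_relations = unital_algebra scale
  for scale :: "'k::field \<Rightarrow> 'u::{ring, monoid_mult} \<Rightarrow> 'u" +
  fixes q :: 'k and X Y Z \<theta> :: 'u
  assumes q_nonzero: "q \<noteq> 0"
    and ZX: "Z * X = scale (inverse (q\<^sup>2)) (X * Z)"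
    and ZY: "Z * Y = scale (q\<^sup>2) (Y * Z)"
    and XY: "X * Y = 1 - scale (q\<^sup>2) (Z * Z)"
    and YX: "Y * X = 1 - scale (inverse (q\<^sup>2)) (Z * Z)"
    and X\<theta>: "X * \<theta> = scale (inverse (q\<^sup>2)) (\<theta> * X) + scale (1 + inverse (q\<^sup>2)) Z"
    and Y\<theta>: "Y * \<theta> = scale (q\<^sup>2) (\<theta> * Y) - scale (1 + q\<^sup>2) Z"
    and Z\<theta>: "Z * \<theta> = \<theta> * Z - Y + X"

lemma is_Uq_imp_relations:
  fixes scale :: "'k::field \<Rightarrow> 'u::{ring, monoid_mult} \<Rightarrow> 'u"
  assumes q: "q \<noteq> 0" and Uq: "is_Uq q scale X Y Z \<theta>"
  shows "uq_relations scale q X Y Z \<theta>"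
proof -
  let ?x = "\<lambda>g. case g of GenX \<Rightarrow> X | GenY \<Rightarrow> Y | GenZ \<Rightarrow> Z | GenTheta \<Rightarrow> \<theta>"
  have pres: "presented_by scale ?x (uq_relators q)"
    using Uq by (simp add: is_Uq_def)
  interpret unital_algebra scale
    using pres by (simp add: presented_by_def)
  interpret R: free_algebra_action scale "\<lambda>g a. ?x g * a"
    by (rule left_mult_action)
  have "\<forall>r\<in>uq_relators q. R.act r 1 = 0"
    using pres two_sided_ideal.generator[of _ "uq_relators q"]
    by (auto simp: presented_by_def free_eval_eq_act)
  then have rel: "X * Z = scale (q\<^sup>2) (Z * X)" "Z * Y = scale (q\<^sup>2) (Y * Z)"
      "X * Y + scale (q\<^sup>2) (Z * Z) = 1" "Y * X + scale (inverse (q\<^sup>2)) (Z * Z) = 1"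
      "scale q (X * \<theta>) - scale (inverse q) (\<theta> * X) = scale (q + inverse q) Z"
      "scale q (\<theta> * Y) - scale (inverse q) (Y * \<theta>) = scale (q + inverse q) Z"
      "\<theta> * Z - Z * \<theta> = Y - X"
    by (simp_all add: uq_relators_def Let_def R.act_diff R.act_plus R.act_times
        power2_eq_square[of "fgen _"])
  show ?thesis
  proof
    show "q \<noteq> 0" by (rule q)
    show "Z * X = scale (inverse (q\<^sup>2)) (X * Z)"
      using q by (simp add: rel(1))
    show "Z * Y = scale (q\<^sup>2) (Y * Z)"
      by (rule rel)
    show "X * Y = 1 - scale (q\<^sup>2) (Z * Z)" "Y * X = 1 - scale (inverse (q\<^sup>2)) (Z * Z)"
      using rel(3,4) by (simp_all add: algebra_simps)
    have "X * \<theta> = scale (inverse q) (scale q (X * \<theta>))"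
      using q by simp
    also have "scale q (X * \<theta>) = scale (inverse q) (\<theta> * X) + scale (q + inverse q) Z"
      using rel(5) by (simp add: algebra_simps)
    finally show "X * \<theta> = scale (inverse (q\<^sup>2)) (\<theta> * X) + scale (1 + inverse (q\<^sup>2)) Z"
      using q by (simp add: scale_right_distrib power2_eq_square distrib_left)
    have "Y * \<theta> = scale q (scale (inverse q) (Y * \<theta>))"
      using q by simp
    also have "scale (inverse q) (Y * \<theta>) = scale q (\<theta> * Y) - scale (q + inverse q) Z"
      using rel(6) by (simp add: algebra_simps)
    finally show "Y * \<theta> = scale (q\<^sup>2) (\<theta> * Y) - scale (1 + q\<^sup>2) Z"
      using q by (simp add: scale_right_diff_distrib power2_eq_square distrib_left add.commute)
    show "Z * \<theta> = \<theta> * Z - Y + X"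
      using rel(7) by (simp add: algebra_simps)
  qed
qed

context uq_relations
begin

definition monomial :: "nat \<Rightarrow> int \<Rightarrow> nat \<Rightarrow> 'u" where
  "monomial m n k = \<theta> ^ m * W_elt X Y n * Z ^ k"

definition monomial_filt :: "nat \<Rightarrow> 'u set" where
  "monomial_filt r = span {monomial m n k | m n k. m + nat \<bar>n\<bar> + k \<le> r}"

lemma subspace_monomial_filt: "subspace (monomial_filt r)"
  by (simp add: monomial_filt_def)

lemma monomial_in_filt: "m + nat \<bar>n\<bar> + k \<le> r \<Longrightarrow> monomial m n k \<in> monomial_filt r"
  unfolding monomial_filt_def by (rule span_base) blast

lemma monomial_filt_mono: "r \<le> r' \<Longrightarrow> monomial_filt r \<subseteq> monomial_filt r'"
  unfolding monomial_filt_def by (rule span_mono) (blast intro: le_trans)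

lemma one_in_monomial_filt: "1 \<in> monomial_filt r"
  using monomial_in_filt[of 0 0 0 r] by (simp add: monomial_def W_elt_def)

lemmas filt_closed =
  subspace_add[OF subspace_monomial_filt] subspace_diff[OF subspace_monomial_filt]
  subspace_scale[OF subspace_monomial_filt]

lemma left_mult_span:
  assumes "subspace S" "\<And>b. b \<in> B \<Longrightarrow> a * b \<in> S" "u \<in> span B"
  shows "a * u \<in> S"
  using assms(3)
proof (induction rule: span_induct_alt)
  case base
  show ?case using assms(1) by (simp add: subspace_0)
next
  case (step c b u)
  then show ?case
    using assms(1,2) by (simp add: distrib_left scale_mult_right subspace_add subspace_scale)
qed

lemma right_mult_span:
  assumes "subspace S" "\<And>b. b \<in> B \<Longrightarrow> b * a \<in> S" "u \<in> span B"
  shows "u * a \<in> S"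
  using assms(3)
proof (induction rule: span_induct_alt)
  case base
  show ?case using assms(1) by (simp add: subspace_0)
next
  case (step c b u)
  then show ?case
    using assms(1,2) by (simp add: distrib_right scale_mult_left subspace_add subspace_scale)
qed

lemma left_mult_filt:
  assumes "\<And>m n k. a * monomial m n k \<in> monomial_filt (m + nat \<bar>n\<bar> + k + d)"
    and "u \<in> monomial_filt r"
  shows "a * u \<in> monomial_filt (r + d)"
proof (rule left_mult_span[OF subspace_monomial_filt])
  show "u \<in> span {monomial m n k | m n k. m + nat \<bar>n\<bar> + k \<le> r}"
    using assms(2) by (simp add: monomial_filt_def)
  fix b assume "b \<in> {monomial m n k | m n k. m + nat \<bar>n\<bar> + k \<le> r}"
  then obtain m n k where "b = monomial m n k" "m + nat \<bar>n\<bar> + k \<le> r" by blast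
  then show "a * b \<in> monomial_filt (r + d)"
    using assms(1)[of m n k] monomial_filt_mono[of "m + nat \<bar>n\<bar> + k + d" "r + d"] by auto
qed

lemma \<theta>_filt: "u \<in> monomial_filt r \<Longrightarrow> \<theta> * u \<in> monomial_filt (r + 1)"
proof (rule left_mult_filt)
  fix m n k
  have "\<theta> * monomial m n k = monomial (Suc m) n k"
    by (simp add: monomial_def mult.assoc)
  then show "\<theta> * monomial m n k \<in> monomial_filt (m + nat \<bar>n\<bar> + k + 1)"
    by (simp add: monomial_in_filt)
qed

lemma Z_W: "\<exists>c. Z * W_elt X Y n = scale c (W_elt X Y n * Z)"
proof -
  have step: "Z * a ^ j = scale (c ^ j) (a ^ j * Z)" if "Z * a = scale c (a * Z)" for a c j
  proof (induction j)
    case (Suc j)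
    have "Z * a ^ Suc j = (Z * a) * a ^ j"
      by (simp add: mult.assoc)
    also have "\<dots> = scale c (a * (Z * a ^ j))"
      using that by (simp add: mult.assoc scale_mult_left)
    finally show ?case
      by (simp add: Suc.IH scale_mult_right mult.assoc)
  qed simp
  show ?thesis
    using step[OF ZX] step[OF ZY] unfolding W_elt_def by (cases "n \<ge> 0") auto
qed

lemma W_succ: "n \<ge> 0 \<Longrightarrow> W_elt X Y (n + 1) = Y * W_elt X Y n"
  by (simp add: W_elt_def nat_add_distrib)

lemma W_pred: "n \<le> 0 \<Longrightarrow> W_elt X Y (n - 1) = X * W_elt X Y n"
  by (cases "n = 0") (simp_all add: W_elt_def Suc_nat_eq_nat_zadd1 flip: power_Suc)

lemma Z_monomial_0: "\<exists>c. Z * monomial 0 n k = scale c (monomial 0 n (Suc k))"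
proof -
  obtain c where c: "Z * W_elt X Y n = scale c (W_elt X Y n * Z)"
    using Z_W by blast
  have "Z * monomial 0 n k = (Z * W_elt X Y n) * Z ^ k"
    by (simp add: monomial_def mult.assoc)
  then show ?thesis
    by (auto simp: c monomial_def scale_mult_left mult.assoc)
qed

text \<open>\<open>X\<close> or \<open>Y\<close> either lengthens the power in \<open>W\<^sup>(\<^sup>n\<^sup>)\<close> or cancels one of its factors, leaving
  \<open>1 - c Z\<^sup>2\<close>. In the second case two factors are replaced by at most two factors \<open>Z\<close>, so the
  degree still does not exceed the number of factors.\<close>

lemma generators_monomial_0:
  "Z * monomial 0 n k \<in> monomial_filt (nat \<bar>n\<bar> + k + 1)"
  "X * monomial 0 n k \<in> monomial_filt (nat \<bar>n\<bar> + k + 1)"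
  "Y * monomial 0 n k \<in> monomial_filt (nat \<bar>n\<bar> + k + 1)"
proof -
  show "Z * monomial 0 n k \<in> monomial_filt (nat \<bar>n\<bar> + k + 1)"
    using Z_monomial_0[of n k] by (auto intro!: filt_closed monomial_in_filt)
  have cancel: "a * b * monomial 0 n' k \<in> monomial_filt (nat \<bar>n'\<bar> + 1 + k + 1)"
    if ab: "a * b = 1 - scale c (Z * Z)" for a b c n'
  proof -
    obtain c1 c2 where "Z * monomial 0 n' k = scale c1 (monomial 0 n' (Suc k))"
      "Z * monomial 0 n' (Suc k) = scale c2 (monomial 0 n' (Suc (Suc k)))"
      using Z_monomial_0 by metis
    then have "a * b * monomial 0 n' k =
        monomial 0 n' k - scale (c * c1 * c2) (monomial 0 n' (Suc (Suc k)))"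
      by (simp add: ab left_diff_distrib scale_mult_left scale_mult_right mult.assoc)
    then show ?thesis
      by (auto intro!: filt_closed monomial_in_filt)
  qed
  show "X * monomial 0 n k \<in> monomial_filt (nat \<bar>n\<bar> + k + 1)"
  proof (cases "n \<le> 0")
    case True
    then have "X * monomial 0 n k = monomial 0 (n - 1) k"
      by (simp add: monomial_def W_pred mult.assoc)
    then show ?thesis using True by (auto intro: monomial_in_filt)
  next
    case False
    then have "X * monomial 0 n k = X * Y * monomial 0 (n - 1) k"
      using W_succ[of "n - 1"] by (simp add: monomial_def mult.assoc)
    moreover have "nat \<bar>n - 1\<bar> + 1 = nat \<bar>n\<bar>" using False by simp
    ultimately show ?thesis using cancel[OF XY, of "n - 1"] by metis
  qed
  show "Y * monomial 0 n k \<in> monomial_filt (nat \<bar>n\<bar> + k + 1)"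
  proof (cases "n \<ge> 0")
    case True
    then have "Y * monomial 0 n k = monomial 0 (n + 1) k"
      by (simp add: monomial_def W_succ mult.assoc)
    then show ?thesis using True by (auto intro: monomial_in_filt)
  next
    case False
    then have "Y * monomial 0 n k = Y * X * monomial 0 (n + 1) k"
      using W_pred[of "n + 1"] by (simp add: monomial_def mult.assoc)
    moreover have "nat \<bar>n + 1\<bar> + 1 = nat \<bar>n\<bar>" using False by simp
    ultimately show ?thesis using cancel[OF YX, of "n + 1"] by metis
  qed
qed

text \<open>Pulling one \<open>\<theta>\<close> to the left of a generator produces \<open>\<theta>\<close> times the same generator and terms
  in which one of \<open>X\<close>, \<open>Y\<close>, \<open>Z\<close> meets the shorter monomial. The correction terms for \<open>X\<close> and
  \<open>Y\<close> involve \<open>Z\<close> and those for \<open>Z\<close> involve \<open>X\<close> and \<open>Y\<close>, so the three claims need a common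
  induction.\<close>

lemma generators_monomial:
  "Z * monomial m n k \<in> monomial_filt (m + nat \<bar>n\<bar> + k + 1) \<and>
   X * monomial m n k \<in> monomial_filt (m + nat \<bar>n\<bar> + k + 1) \<and>
   Y * monomial m n k \<in> monomial_filt (m + nat \<bar>n\<bar> + k + 1)"
proof (induction m)
  case 0
  show ?case using generators_monomial_0 by simp
next
  case (Suc m)
  let ?r = "m + nat \<bar>n\<bar> + k + 1"
  have in_succ: "u \<in> monomial_filt (?r + 1)" "\<theta> * u \<in> monomial_filt (?r + 1)"
    if "u \<in> monomial_filt ?r" for u
    using that monomial_filt_mono[of ?r "?r + 1"] \<theta>_filt by auto
  have split: "a * monomial (Suc m) n k = (a * \<theta>) * monomial m n k" for a
    by (simp add: monomial_def mult.assoc)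
  have "Z * monomial (Suc m) n k =
      \<theta> * (Z * monomial m n k) - Y * monomial m n k + X * monomial m n k"
    by (simp add: split Z\<theta> distrib_right left_diff_distrib mult.assoc)
  moreover have "X * monomial (Suc m) n k =
      scale (inverse (q\<^sup>2)) (\<theta> * (X * monomial m n k))
      + scale (1 + inverse (q\<^sup>2)) (Z * monomial m n k)"
    by (simp add: split X\<theta> distrib_right scale_mult_left mult.assoc)
  moreover have "Y * monomial (Suc m) n k =
      scale (q\<^sup>2) (\<theta> * (Y * monomial m n k)) - scale (1 + q\<^sup>2) (Z * monomial m n k)"
    by (simp add: split Y\<theta> left_diff_distrib scale_mult_left mult.assoc)
  moreover have "Z * monomial m n k \<in> monomial_filt ?r" "X * monomial m n k \<in> monomial_filt ?r"
      "Y * monomial m n k \<in> monomial_filt ?r"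
    using Suc.IH by simp_all
  note this[THEN in_succ(1)] this[THEN in_succ(2)]
  ultimately show ?case
    by (simp add: filt_closed)
qed

lemma generators_filt:
  assumes "u \<in> monomial_filt r" "a \<in> {X, Y, Z, \<theta>}"
  shows "a * u \<in> monomial_filt (r + 1)"
  using assms \<theta>_filt left_mult_filt[of a 1 u r] generators_monomial by auto

lemma power_generators_filt:
  assumes "u \<in> monomial_filt r" "a \<in> {X, Y, Z, \<theta>}"
  shows "a ^ j * u \<in> monomial_filt (r + j)"
proof (induction j)
  case (Suc j)
  then show ?case
    using generators_filt[OF Suc assms(2)] by (simp add: mult.assoc)
qed (simp add: assms)

text \<open>A normally ordered monomial of degree \<open>r\<close> is a product of \<open>r\<close> generators, each of which raises
  the degree by at most one.\<close>

lemma monomial_filt_mult: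
  assumes "u \<in> monomial_filt r" "v \<in> monomial_filt s"
  shows "u * v \<in> monomial_filt (r + s)"
proof (rule right_mult_span[OF subspace_monomial_filt])
  show "u \<in> span {monomial m n k | m n k. m + nat \<bar>n\<bar> + k \<le> r}"
    using assms(1) by (simp add: monomial_filt_def)
  fix b assume "b \<in> {monomial m n k | m n k. m + nat \<bar>n\<bar> + k \<le> r}"
  then obtain m n k where b: "b = monomial m n k" "m + nat \<bar>n\<bar> + k \<le> r" by blast
  have "Z ^ k * v \<in> monomial_filt (s + k)"
    using assms(2) by (rule power_generators_filt) simp
  then have "W_elt X Y n * (Z ^ k * v) \<in> monomial_filt (s + k + nat \<bar>n\<bar>)"
    using power_generators_filt[of "Z ^ k * v" "s + k" X "nat \<bar>n\<bar>"]
      power_generators_filt[of "Z ^ k * v" "s + k" Y "nat \<bar>n\<bar>"]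
    by (cases "n \<ge> 0") (simp_all add: W_elt_def)
  then have "\<theta> ^ m * (W_elt X Y n * (Z ^ k * v)) \<in> monomial_filt (s + k + nat \<bar>n\<bar> + m)"
    by (rule power_generators_filt) simp
  moreover have "monomial_filt (s + k + nat \<bar>n\<bar> + m) \<subseteq> monomial_filt (r + s)"
    using b(2) by (intro monomial_filt_mono) simp
  ultimately show "b * v \<in> monomial_filt (r + s)"
    by (auto simp: b(1) monomial_def mult.assoc)
qed

lemma prod_list_generators_filt:
  "set as \<subseteq> {X, Y, Z, \<theta>} \<Longrightarrow> prod_list as \<in> monomial_filt (length as)"
proof (induction as)
  case Nil
  then show ?case by (simp add: one_in_monomial_filt)
next
  case (Cons a as)
  then show ?case using generators_filt[of "prod_list as" "length as" a] by simp
qed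

abbreviation "monomial_family \<equiv> (\<lambda>(m :: nat, n :: int, k :: nat). \<theta> ^ m * W_elt X Y n * Z ^ k)"

lemma monomial_filt_exhausts: "(\<Union>r. monomial_filt r) = span (range monomial_family)"
proof (intro equalityI subsetI)
  fix u assume "u \<in> (\<Union>r. monomial_filt r)"
  then obtain r where "u \<in> monomial_filt r" by blast
  moreover have "monomial_filt r \<subseteq> span (range monomial_family)"
    unfolding monomial_filt_def monomial_def by (intro span_mono) (auto simp: image_iff, blast)
  ultimately show "u \<in> span (range monomial_family)" by blast
next
  fix u assume "u \<in> span (range monomial_family)"
  then show "u \<in> (\<Union>r. monomial_filt r)"
  proof (induction rule: span_induct_alt)
    case base
    show ?case using subspace_0[OF subspace_monomial_filt] by blast
  next
    case (step c b u)
    then obtain m n k r where "b = monomial m n k" and u: "u \<in> monomial_filt r"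
      by (auto simp: monomial_def)
    then have "b \<in> monomial_filt (r + (m + nat \<bar>n\<bar> + k))"
      by (auto intro: monomial_in_filt)
    moreover have "u \<in> monomial_filt (r + (m + nat \<bar>n\<bar> + k))"
      using u monomial_filt_mono[of r "r + (m + nat \<bar>n\<bar> + k)"] by auto
    ultimately show ?case by (blast intro: filt_closed)
  qed
qed

text \<open>Each summand \<open>\<theta>\<^sup>n O\<^sup>(\<^sup>r\<^sup>-\<^sup>n\<^sup>)\<close> is spanned by monomials of degree at most \<open>r\<close>, and each such
  monomial lies in one summand. The remaining point is that a Minkowski sum of subspaces is a
  subspace.\<close>

lemma Uq_filt_eq_monomial_filt: "Uq_filt scale X Y Z \<theta> r = monomial_filt r"
proof (intro equalityI subsetI)
  have O: "\<theta> ^ n * w \<in> monomial_filt r" if "n \<le> r" "w \<in> O_filt scale X Y Z (r - n)" for n w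
  proof (rule left_mult_span[OF subspace_monomial_filt])
    show "w \<in> span {W_elt X Y n' * Z ^ m | n' m. nat \<bar>n'\<bar> + m \<le> r - n}"
      using that(2) by (simp add: O_filt_def)
    fix b assume "b \<in> {W_elt X Y n' * Z ^ m | n' m. nat \<bar>n'\<bar> + m \<le> r - n}"
    then obtain n' m where "b = W_elt X Y n' * Z ^ m" "nat \<bar>n'\<bar> + m \<le> r - n" by blast
    then show "\<theta> ^ n * b \<in> monomial_filt r"
      using monomial_in_filt[of n n' m r] that(1) by (simp add: monomial_def mult.assoc)
  qed
  fix u assume "u \<in> Uq_filt scale X Y Z \<theta> r"
  then obtain s where u: "u = sum s {0..r}"
    and s: "\<And>n. n \<in> {0..r} \<Longrightarrow> s n \<in> (\<theta> ^ n) *o O_filt scale X Y Z (r - n)"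
    unfolding Uq_filt_def by (auto simp: set_sum_alt)
  show "u \<in> monomial_filt r"
    unfolding u using s O by (intro subspace_sum subspace_monomial_filt) (force simp: elt_set_times_def)
next
  define F where "F n = (\<theta> ^ n) *o O_filt scale X Y Z (r - n)" for n
  have O: "subspace (O_filt scale X Y Z i)" for i
    by (simp add: O_filt_def)
  have sub: "subspace (F n)" for n
    unfolding subspace_def
  proof (intro conjI ballI allI)
    show "0 \<in> F n"
      using subspace_0[OF O, of "r - n"] set_times_intro2[of 0 _ "\<theta> ^ n"] by (simp add: F_def)
    fix u assume "u \<in> F n"
    then obtain a where a: "a \<in> O_filt scale X Y Z (r - n)" "u = \<theta> ^ n * a"
      by (auto simp: F_def elt_set_times_def)
    show "scale c u \<in> F n" for c
      using subspace_scale[OF O a(1)] set_times_intro2[of "scale c a" _ "\<theta> ^ n"]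
      by (simp add: F_def a(2) scale_mult_right)
    fix v assume "v \<in> F n"
    then obtain b where b: "b \<in> O_filt scale X Y Z (r - n)" "v = \<theta> ^ n * b"
      by (auto simp: F_def elt_set_times_def)
    show "u + v \<in> F n"
      using subspace_add[OF O a(1) b(1)] set_times_intro2[of "a + b" _ "\<theta> ^ n"]
      by (simp add: F_def a(2) b(2) distrib_left)
  qed
  have sum_F: "Uq_filt scale X Y Z \<theta> r = {sum s {0..r} | s. \<forall>n\<in>{0..r}. s n \<in> F n}"
    unfolding Uq_filt_def F_def by (simp add: set_sum_alt)
  have Uq_sub: "subspace (Uq_filt scale X Y Z \<theta> r)"
    unfolding sum_F subspace_def
  proof (intro conjI ballI allI)
    show "0 \<in> {sum s {0..r} | s. \<forall>n\<in>{0..r}. s n \<in> F n}"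
      using sub by (auto simp: subspace_0 intro!: exI[of _ "\<lambda>_. 0"])
    show "u + v \<in> {sum s {0..r} | s. \<forall>n\<in>{0..r}. s n \<in> F n}"
      if uv: "u \<in> {sum s {0..r} | s. \<forall>n\<in>{0..r}. s n \<in> F n}"
        "v \<in> {sum s {0..r} | s. \<forall>n\<in>{0..r}. s n \<in> F n}" for u v
    proof -
      obtain s t where "u = sum s {0..r}" "v = sum t {0..r}"
        "\<forall>n\<in>{0..r}. s n \<in> F n" "\<forall>n\<in>{0..r}. t n \<in> F n"
        using uv by blast
      then show ?thesis
        using sub by (auto simp: subspace_add simp flip: sum.distrib intro!: exI[of _ "\<lambda>n. s n + t n"])
    qed
    show "scale c u \<in> {sum s {0..r} | s. \<forall>n\<in>{0..r}. s n \<in> F n}"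
      if u: "u \<in> {sum s {0..r} | s. \<forall>n\<in>{0..r}. s n \<in> F n}" for c u
    proof -
      obtain s where "u = sum s {0..r}" "\<forall>n\<in>{0..r}. s n \<in> F n"
        using u by blast
      then show ?thesis
        using sub by (auto simp: subspace_scale scale_sum_right intro!: exI[of _ "\<lambda>n. scale c (s n)"])
    qed
  qed
  have monomials: "monomial m n k \<in> Uq_filt scale X Y Z \<theta> r" if "m + nat \<bar>n\<bar> + k \<le> r" for m n k
  proof -
    let ?s = "\<lambda>i. if i = m then monomial m n k else 0"
    have "W_elt X Y n * Z ^ k \<in> O_filt scale X Y Z (r - m)"
      unfolding O_filt_def using that by (intro span_base) force
    then have "monomial m n k \<in> F m"
      by (auto simp: F_def elt_set_times_def monomial_def mult.assoc)
    then have "\<forall>i\<in>{0..r}. ?s i \<in> F i"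
      using sub by (simp add: subspace_0)
    moreover have "sum ?s {0..r} = monomial m n k"
      using that by simp
    ultimately show ?thesis
      unfolding sum_F by (intro CollectI exI[of _ ?s]) simp
  qed
  have "monomial_filt r \<subseteq> Uq_filt scale X Y Z \<theta> r"
    unfolding monomial_filt_def by (rule span_minimal[OF _ Uq_sub]) (auto simp: monomials)
  then show "u \<in> Uq_filt scale X Y Z \<theta> r" if "u \<in> monomial_filt r" for u
    using that by blast
qed

lemma Uq_filt_algebra_filtration:
  assumes "span (range monomial_family) = UNIV"
  shows "algebra_filtration scale (Uq_filt scale X Y Z \<theta>)"
  unfolding algebra_filtration_def
proof (intro conjI allI)
  show "subspace (Uq_filt scale X Y Z \<theta> r)" for r
    by (simp add: Uq_filt_eq_monomial_filt subspace_monomial_filt)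
  show "mono (Uq_filt scale X Y Z \<theta>)"
    by (simp add: Uq_filt_eq_monomial_filt monomial_filt_mono monoI)
  show "(\<Union>r. Uq_filt scale X Y Z \<theta> r) = UNIV"
    using assms monomial_filt_exhausts by (simp add: Uq_filt_eq_monomial_filt)
  show "1 \<in> Uq_filt scale X Y Z \<theta> 0"
    by (simp add: Uq_filt_eq_monomial_filt one_in_monomial_filt)
  show "Uq_filt scale X Y Z \<theta> r * Uq_filt scale X Y Z \<theta> s \<subseteq> Uq_filt scale X Y Z \<theta> (r + s)" for r s
    by (auto simp: Uq_filt_eq_monomial_filt set_times_def monomial_filt_mult)
qed

lemma monomials_span:
  assumes "is_Uq q scale X Y Z \<theta>"
  shows "span (range monomial_family) = UNIV"
proof -
  let ?x = "\<lambda>g. case g of GenX \<Rightarrow> X | GenY \<Rightarrow> Y | GenZ \<Rightarrow> Z | GenTheta \<Rightarrow> \<theta>"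
  have "free_eval scale ?x p \<in> span (range monomial_family)" for p
    unfolding free_eval_def
  proof (intro span_sum span_scale)
    fix w
    have "prod_list (map ?x (letters w)) \<in> monomial_filt (length (map ?x (letters w)))"
      by (rule prod_list_generators_filt) (auto split: uq_gen.split)
    then show "prod_list (map ?x (letters w)) \<in> span (range monomial_family)"
      unfolding monomial_filt_exhausts[symmetric] by blast
  qed
  then have "range (free_eval scale ?x) \<subseteq> span (range monomial_family)"
    by (rule image_subsetI)
  moreover have "surj (free_eval scale ?x)"
    using assms by (simp add: is_Uq_def presented_by_def)
  ultimately show ?thesis
    by (simp add: top.extremum_unique)
qed

end

section \<open>Linear independence\<close>

lemma leads_powers:
  assumes "q \<noteq> 0" "leads f a b c"
  shows "leads ((torus_action q GenX ^^ j) f) a (b + int j) c"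
    and "leads ((torus_action q GenY ^^ j) f) a (b - int j) c"
    and "leads ((torus_action q GenZ ^^ j) f) a b (c + int j)"
    and "leads ((torus_action q GenTheta ^^ j) f) (a + int j) b (c - int j)"
proof (induction j)
  case (Suc j)
  {
    case 1
    show ?case using leads_torus_action(1)[OF Suc(1) assms(1)] by (simp add: ac_simps)
  next
    case 2
    show ?case using leads_torus_action(2)[OF Suc(2) assms(1)] by (simp add: algebra_simps)
  next
    case 3
    show ?case using leads_torus_action(3)[OF Suc(3) assms(1)] by (simp add: ac_simps)
  next
    case 4
    show ?case using leads_torus_action(4)[OF Suc(4) assms(1)] by (simp add: algebra_simps)
  }
qed (use assms in simp_all)

lemma monomials_independent:
  fixes q :: "'k::field" and scale :: "'k \<Rightarrow> 'u::{ring, monoid_mult} \<Rightarrow> 'u"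
  assumes q: "q \<noteq> 0" "q\<^sup>2 \<noteq> 1" and Uq: "is_Uq q scale X Y Z \<theta>"
  defines "f \<equiv> \<lambda>(m :: nat, n :: int, k :: nat). \<theta> ^ m * W_elt X Y n * Z ^ k"
  shows "inj f" and "\<not> module.dependent scale (range f)"
proof -
  let ?x = "\<lambda>g. case g of GenX \<Rightarrow> X | GenY \<Rightarrow> Y | GenZ \<Rightarrow> Z | GenTheta \<Rightarrow> \<theta>"
  let ?T = "torus_action q"
  define e :: "'k torus_series" where "e a b c = (if a = 0 \<and> b = 0 \<and> c = 0 then 1 else 0)" for a b c
  have pres: "presented_by scale ?x (uq_relators q)"
    using Uq by (simp add: is_Uq_def)
  obtain L where L: "Vector_Spaces.linear scale series_scale L" "L 1 = e"
      and L_gen: "\<And>g a. L (?x g * a) = ?T g (L a)"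
    using presented_by_module_map[OF pres torus_action_free torus_action_relators[OF q]] by metis
  interpret L: Vector_Spaces.linear scale series_scale L
    by (rule L(1))
  have L_power: "L (?x g ^ j * a) = (?T g ^^ j) (L a)" for g j a
  proof (induction j)
    case (Suc j)
    show ?case
      using L_gen[of g "?x g ^ j * a"] Suc by (simp add: mult.assoc)
  qed simp
  note L_powers = L_power[of GenX, simplified] L_power[of GenY, simplified]
    L_power[of GenZ, simplified] L_power[of GenTheta, simplified]
  have lead: "leads (L (f (m, n, k))) (int m) (- n) (int k - int m)" for m n k
  proof -
    have "leads e 0 0 0" by (simp add: e_def leads_def)
    from leads_powers(3)[OF q(1) this, of k] have "leads (L (Z ^ k)) 0 0 (int k)"
      using L_powers(3)[of k 1] L(2) by simp
    from leads_powers(1,2)[OF q(1) this, of "nat \<bar>n\<bar>"]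
    have "leads (L (W_elt X Y n * Z ^ k)) 0 (- n) (int k)"
      by (cases "n \<ge> 0") (simp_all add: W_elt_def L_powers)
    from leads_powers(4)[OF q(1) this, of m] show ?thesis
      by (simp add: f_def L_powers mult.assoc)
  qed
  have tri: "\<exists>i\<in>S. \<exists>\<phi>. Vector_Spaces.linear scale (*) \<phi> \<and> \<phi> (f i) \<noteq> 0 \<and> (\<forall>j\<in>S - {i}. \<phi> (f j) = 0)"
    if S: "finite S" "S \<noteq> {}" for S
  proof -
    obtain i0 where i0: "i0 \<in> S" "\<And>j. j \<in> S \<Longrightarrow> fst j \<le> fst i0"
    proof -
      have "Max (fst ` S) \<in> fst ` S" using S by simp
      then obtain i where "i \<in> S" "fst i = Max (fst ` S)" by auto
      with that S(1) show ?thesis by simp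
    qed
    \<comment> \<open>The leading exponents of \<open>(m', n', k')\<close> can only cover the exponent \<open>(m, - n, k - m)\<close> if
      \<open>m < m'\<close>, or \<open>m' = m\<close>, \<open>n' = n\<close> and \<open>k' \<le> k\<close>. Hence \<open>m\<close> is chosen maximal, and then \<open>k\<close>
      minimal.\<close>
    define S' where "S' = {j \<in> S. fst j = fst i0}"
    obtain i where i: "i \<in> S'" "\<And>j. j \<in> S' \<Longrightarrow> snd (snd i) \<le> snd (snd j)"
    proof -
      have "finite S'" using S(1) by (simp add: S'_def)
      moreover have "S' \<noteq> {}" using i0(1) unfolding S'_def by blast
      ultimately obtain i where "is_arg_min (snd \<circ> snd) (\<lambda>i. i \<in> S') i"
        using ex_is_arg_min_if_finite by blast
      then have "i \<in> S'" "\<forall>j\<in>S'. snd (snd i) \<le> snd (snd j)"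
        by (auto simp: is_arg_min_linorder)
      then show ?thesis by (intro that) auto
    qed
    obtain m n k where mnk: "i = (m, n, k)" by (cases i)
    define \<phi> where "\<phi> u = L u (int m) (- n) (int k - int m)" for u
    have "Vector_Spaces.linear scale (*) \<phi>"
      by unfold_locales
        (simp_all add: \<phi>_def L.add L.scale series_scale_def algebra_simps)
    moreover have "\<phi> (f i) \<noteq> 0"
      using lead[of m n k] by (simp add: mnk \<phi>_def leads_def)
    moreover have "\<phi> (f j) = 0" if j: "j \<in> S - {i}" for j
    proof (rule ccontr)
      assume "\<phi> (f j) \<noteq> 0"
      obtain m' n' k' where j': "j = (m', n', k')" by (cases j)
      have "m' \<le> m" using i0(2)[of j] i(1) j j' mnk by (auto simp: S'_def)
      moreover have "int m < int m' \<or> int m = int m' \<and> - n = - n' \<and> int k' - int m' \<le> int k - int m"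
        using lead[of m' n' k'] \<open>\<phi> (f j) \<noteq> 0\<close> unfolding leads_def \<phi>_def j' by blast
      ultimately have "m = m'" "n = n'" "k' \<le> k" by auto
      moreover from this have "k \<le> k'"
        using i(1) i(2)[of j] j j' mnk by (auto simp: S'_def)
      ultimately show False using j j' mnk by simp
    qed
    ultimately show ?thesis using i(1) unfolding S'_def by blast
  qed
  show "inj f" "\<not> module.dependent scale (range f)"
    using L.vs1.triangular_family_independent[of f] tri by auto
qed

theorem corollary3p2:
  fixes emb :: "complex \<Rightarrow> 'k::field" and star :: "'k \<Rightarrow> 'k" and q :: 'k
    and scale :: "'k \<Rightarrow> 'u::{ring, monoid_mult} \<Rightarrow> 'u"
    and X Y Z \<theta> :: 'u
  assumes "involutive_extension emb star"
    and "q \<noteq> 0"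
    and "\<forall>n::nat. n > 0 \<longrightarrow> q ^ n \<noteq> 1"
    and "\<exists>s. s\<^sup>2 = q \<and> involutive_extension.self_adjoint star s"
    and "is_Uq q scale X Y Z \<theta>"
  shows "is_basis_family scale
           (\<lambda>(m1 :: nat, n :: int, m2 :: nat). \<theta> ^ m1 * W_elt X Y n * Z ^ m2)
         \<and> algebra_filtration scale (Uq_filt scale X Y Z \<theta>)"
proof -
  interpret uq_relations scale q X Y Z \<theta>
    using assms(2,5) by (rule is_Uq_imp_relations)
  have "q\<^sup>2 \<noteq> 1" using assms(3) by simp
  note indep = monomials_independent[OF assms(2) this assms(5)]
  have span: "span (range monomial_family) = UNIV"
    using assms(5) by (rule monomials_span)
  show ?thesis
    unfolding is_basis_family_def
    by (intro conjI indep span Uq_filt_algebra_filtration[OF span])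
qed

end
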